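(* Let $n\ge2$ and let $g=(g_1,\dots,g_n):\mathbb{R}^2\to\mathbb{R}^n$ be a $C^2$ map whose graph $\{(x,y,g_1(x,y),\dots,g_n(x,y)):(x,y)\in\mathbb{R}^2\}$ is a maximal surface in $\mathbb{R}^{n+2}_n$ with a positive area-angle function. Then this graph is a spacelike plane.
   Context: $\mathbb{R}^{n+2}_n$ is $\mathbb{R}^{n+2}$ with the pseudo-Euclidean metric $dx_1^2+dx_2^2-dx_3^2-\cdots-dx_{n+2}^2$. A maximal surface is a spacelike surface (the induced metric is positive definite) of zero mean curvature. For the graph of $g$, put $\widehat{E}=1-\sum_k(\partial_x g_k)^2$, $\widehat{F}=-\sum_k\partial_x g_k\,\partial_y g_k$, $\widehat{G}=1-\sum_k(\partial_y g_k)^2$; a spacelike graph is maximal if and only if $\widehat{G}\,\partial_{xx}g_k-2\widehat{F}\,\partial_{xy}g_k+\widehat{E}\,\partial_{yy}g_k=0$ for all $k$. The graph of $g$ has a positive area-angle function if $\sqrt{\sum_{1\le i<j\le n}\left(\frac{\partial(g_i,g_j)}{\partial(x,y)}\right)^2}<1$ at every point of the domain $\mathbb{R}^2$. *)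

theory Defs
  imports "HOL-Analysis.Analysis"
begin

definition partial_x :: "(real \<times> real \<Rightarrow> 'a::real_normed_vector) \<Rightarrow> real \<times> real \<Rightarrow> 'a" where
  "partial_x f = (\<lambda>(x, y). vector_derivative (\<lambda>s. f (s, y)) (at x))"

definition partial_y :: "(real \<times> real \<Rightarrow> 'a::real_normed_vector) \<Rightarrow> real \<times> real \<Rightarrow> 'a" where
  "partial_y f = (\<lambda>(x, y). vector_derivative (\<lambda>t. f (x, t)) (at y))"

definition C1_plane :: "(real \<times> real \<Rightarrow> 'a::real_normed_vector) \<Rightarrow> bool" where
  "C1_plane f \<longleftrightarrow>
     (\<forall>x y. (\<lambda>s. f (s, y)) differentiable at x) \<and>
     (\<forall>x y. (\<lambda>t. f (x, t)) differentiable at y) \<and>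
     continuous_on UNIV (partial_x f) \<and> continuous_on UNIV (partial_y f)"

definition C2_plane :: "(real \<times> real \<Rightarrow> 'a::real_normed_vector) \<Rightarrow> bool" where
  "C2_plane f \<longleftrightarrow> C1_plane f \<and> C1_plane (partial_x f) \<and> C1_plane (partial_y f)"

text \<open>The ambient space of dimension \<open>n + 2\<close> and signature \<open>(2, n)\<close> is the type
  \<open>real \<times> real \<times> (real ^ 'n)\<close> with \<open>n = CARD('n)\<close>.\<close>

definition pseudo_inner ::
    "real \<times> real \<times> (real ^ 'n) \<Rightarrow> real \<times> real \<times> (real ^ 'n) \<Rightarrow> real" where
  "pseudo_inner = (\<lambda>(a, b, u) (c, d, v). a * c + b * d - (\<Sum>k\<in>UNIV. u $ k * v $ k))"

text \<open>Coefficients of the induced metric of a parametrized surface \<open>X\<close>.\<close>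

definition ff_E :: "(real \<times> real \<Rightarrow> real \<times> real \<times> (real ^ 'n)) \<Rightarrow> real \<times> real \<Rightarrow> real" where
  "ff_E X p = pseudo_inner (partial_x X p) (partial_x X p)"

definition ff_F :: "(real \<times> real \<Rightarrow> real \<times> real \<times> (real ^ 'n)) \<Rightarrow> real \<times> real \<Rightarrow> real" where
  "ff_F X p = pseudo_inner (partial_x X p) (partial_y X p)"

definition ff_G :: "(real \<times> real \<Rightarrow> real \<times> real \<times> (real ^ 'n)) \<Rightarrow> real \<times> real \<Rightarrow> real" where
  "ff_G X p = pseudo_inner (partial_y X p) (partial_y X p)"

definition spacelike :: "(real \<times> real \<Rightarrow> real \<times> real \<times> (real ^ 'n)) \<Rightarrow> bool" where
  "spacelike X \<longleftrightarrow>
     (\<forall>p a b. (a, b) \<noteq> (0, 0) \<longrightarrow>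
        ff_E X p * a\<^sup>2 + 2 * ff_F X p * a * b + ff_G X p * b\<^sup>2 > 0)"

text \<open>Component of \<open>w\<close> orthogonal, with respect to \<open>pseudo_inner\<close>, to the tangent plane of \<open>X\<close>
  at \<open>p\<close>; the subtracted tangential coefficients solve the \<open>2 \<times> 2\<close> Gram system (Cramer's rule).\<close>

definition normal_part ::
    "(real \<times> real \<Rightarrow> real \<times> real \<times> (real ^ 'n)) \<Rightarrow> real \<times> real \<Rightarrow>
      real \<times> real \<times> (real ^ 'n) \<Rightarrow> real \<times> real \<times> (real ^ 'n)" where
  "normal_part X p w =
     (let E = ff_E X p; F = ff_F X p; G = ff_G X p;
          u = pseudo_inner w (partial_x X p); v = pseudo_inner w (partial_y X p)
      in w - ((G * u - F * v) / (E * G - F\<^sup>2)) *\<^sub>R partial_x X p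
           - ((E * v - F * u) / (E * G - F\<^sup>2)) *\<^sub>R partial_y X p)"

text \<open>Half the trace, with respect to the induced metric, of the vector-valued second fundamental
  form, whose coefficients are the normal parts of the second derivatives of \<open>X\<close>
  (the ambient connection is flat).\<close>

definition mean_curvature ::
    "(real \<times> real \<Rightarrow> real \<times> real \<times> (real ^ 'n)) \<Rightarrow> real \<times> real \<Rightarrow> real \<times> real \<times> (real ^ 'n)" where
  "mean_curvature X p =
     (1 / (2 * (ff_E X p * ff_G X p - (ff_F X p)\<^sup>2))) *\<^sub>R
       (ff_G X p *\<^sub>R normal_part X p (partial_x (partial_x X) p)
        - (2 * ff_F X p) *\<^sub>R normal_part X p (partial_y (partial_x X) p)
        + ff_E X p *\<^sub>R normal_part X p (partial_y (partial_y X) p))"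

definition maximal_surface :: "(real \<times> real \<Rightarrow> real \<times> real \<times> (real ^ 'n)) \<Rightarrow> bool" where
  "maximal_surface X \<longleftrightarrow> spacelike X \<and> (\<forall>p. mean_curvature X p = 0)"

definition graph_map ::
    "(real \<times> real \<Rightarrow> real ^ 'n) \<Rightarrow> real \<times> real \<Rightarrow> real \<times> real \<times> (real ^ 'n)" where
  "graph_map g = (\<lambda>(x, y). (x, y, g (x, y)))"

definition jacobian ::
    "(real \<times> real \<Rightarrow> real) \<Rightarrow> (real \<times> real \<Rightarrow> real) \<Rightarrow> real \<times> real \<Rightarrow> real" where
  "jacobian f h p = partial_x f p * partial_y h p - partial_y f p * partial_x h p"

definition positive_area_angle ::
    "(real \<times> real \<Rightarrow> real ^ 'n::{finite,linorder}) \<Rightarrow> bool" where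
  "positive_area_angle g \<longleftrightarrow>
     (\<forall>p. sqrt (\<Sum>(i, j)\<in>{(i, j). i < j}. (jacobian (\<lambda>q. g q $ i) (\<lambda>q. g q $ j) p)\<^sup>2) < 1)"

definition spacelike_plane :: "(real \<times> real \<times> (real ^ 'n)) set \<Rightarrow> bool" where
  "spacelike_plane S \<longleftrightarrow> affine S \<and> aff_dim S = 2 \<and>
     (\<forall>p\<in>S. \<forall>q\<in>S. p \<noteq> q \<longrightarrow> pseudo_inner (p - q) (p - q) > 0)"

end

theory Submission
  imports Defs "HOL-Complex_Analysis.Cauchy_Integral_Formula"
begin

text \<open>Put \<open>W = sqrt (E G - F\<^sup>2)\<close>. The maximal surface equation makes the forms
  \<open>(E dx + F dy) / W\<close> and \<open>(F dx + G dy) / W\<close> closed, so their potentials \<open>M\<close>, \<open>N\<close> have the symmetric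
  positive definite Jacobian matrix \<open>(E, F; F, G) / W\<close> of determinant 1. By Joergens' theorem this
  matrix is constant, and the maximal surface equation becomes a linear elliptic equation with constant
  coefficients. The gradient of each \<open>g\<^sub>k\<close> is bounded because the graph is spacelike, hence
  constant by Liouville's theorem.\<close>

section \<open>Functions on the plane with continuous partial derivatives\<close>

text \<open>The partial derivatives are explicit arguments, so that using one function in two places
  expresses an identity such as \<open>P_y = Q_x\<close>.\<close>

definition has_partials ::
    "(real \<times> real \<Rightarrow> real) \<Rightarrow> (real \<times> real \<Rightarrow> real) \<Rightarrow> (real \<times> real \<Rightarrow> real) \<Rightarrow> bool" where
  "has_partials f fx fy \<longleftrightarrow>
     (\<forall>x y. ((\<lambda>s. f (s, y)) has_real_derivative fx (x, y)) (at x)) \<and>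
     (\<forall>x y. ((\<lambda>t. f (x, t)) has_real_derivative fy (x, y)) (at y)) \<and>
     continuous_on UNIV fx \<and> continuous_on UNIV fy"

lemma C1_planeD:
  assumes "C1_plane f"
  shows "((\<lambda>s. f (s, y)) has_vector_derivative partial_x f (x, y)) (at x)"
    and "((\<lambda>t. f (x, t)) has_vector_derivative partial_y f (x, y)) (at y)"
    and "continuous_on UNIV (partial_x f)" "continuous_on UNIV (partial_y f)"
  using assms by (auto simp: C1_plane_def partial_x_def partial_y_def vector_derivative_works)

lemma has_partials_component:
  assumes "C1_plane f"
  shows "has_partials (\<lambda>p. f p $ k) (\<lambda>p. partial_x f p $ k) (\<lambda>p. partial_y f p $ k)"
proof -
  have "((\<lambda>s. u s $ k) has_real_derivative u' $ k) F"
    if "(u has_vector_derivative u') F" for u :: "real \<Rightarrow> real^'a" and u' F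
    using bounded_linear.has_vector_derivative[OF bounded_linear_vec_nth that]
    by (simp add: has_real_derivative_iff_has_vector_derivative)
  with C1_planeD[OF assms] show ?thesis
    unfolding has_partials_def by (auto intro!: continuous_intros)
qed

lemma has_partials_imp_has_derivative:
  assumes "has_partials f fx fy"
  shows "(f has_derivative (\<lambda>h. fst h * fx p + snd h * fy p)) (at p)"
proof -
  obtain x y where p: "p = (x, y)" by fastforce
  have "((\<lambda>(x, y). f (x, y)) has_derivative
      (\<lambda>(tx, ty). fx (x, y) * tx + blinfun_apply (blinfun_mult_right (fy (x, y))) ty))
      (at (x, y) within UNIV \<times> UNIV)"
  proof (rule has_derivative_partialsI)
    show "((\<lambda>x. f (x, y)) has_derivative (*) (fx (x, y))) (at x within UNIV)"
      using assms by (simp add: has_partials_def has_field_derivative_def)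
    show "((\<lambda>y. f (x, y)) has_derivative blinfun_apply (blinfun_mult_right (fy (x, y)))) (at y within UNIV)" for x y
      using assms by (simp add: has_partials_def has_field_derivative_def)
    have "continuous_on UNIV (\<lambda>p. blinfun_mult_right (fy p))"
      using assms by (auto simp: has_partials_def intro!: continuous_intros)
    then show "continuous (at (x, y) within UNIV \<times> UNIV) (\<lambda>(x, y). blinfun_mult_right (fy (x, y)))"
      by (simp add: continuous_on_eq_continuous_within split_def)
  qed auto
  then show ?thesis by (simp add: p split_def mult.commute)
qed

lemma has_partials_continuous_on:
  assumes "has_partials f fx fy"
  shows "continuous_on S f"
  using has_partials_imp_has_derivative[OF assms]
  by (meson has_derivative_continuous continuous_at_imp_continuous_on)

lemma has_partials_compose:
  assumes f: "has_partials f fx fy"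
    and u: "(u has_real_derivative u') (at s within S)"
    and v: "(v has_real_derivative v') (at s within S)"
  shows "((\<lambda>s. f (u s, v s)) has_real_derivative u' * fx (u s, v s) + v' * fy (u s, v s)) (at s within S)"
proof -
  have "((\<lambda>s. (u s, v s)) has_derivative (\<lambda>h. (u' * h, v' * h))) (at s within S)"
    using u v by (intro has_derivative_Pair) (auto simp: has_field_derivative_def)
  from has_derivative_compose[OF this has_partials_imp_has_derivative[OF f]]
  show ?thesis unfolding has_field_derivative_def
    by (rule has_derivative_eq_rhs) (auto simp: algebra_simps)
qed

text \<open>Differentiating \<open>f (s, z) - f (s, c) = integral of fy\<close> under the integral
  sign gives \<open>fx (x, z) - fx (x, c)\<close> as the integral of \<open>fyx\<close> over
  \<open>{c..z}\<close>. Differentiating in \<open>z\<close> then yields the claim.\<close>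

lemma mixed_partials_eq:
  assumes f: "has_partials f fx fy" and fx: "has_partials fx fxx fxy"
    and fy: "has_partials fy fyx fyy"
  shows "fxy p = fyx p"
proof -
  obtain x y where p: "p = (x, y)" by fastforce
  \<comment> \<open>The base point lies strictly below \<open>y\<close>, so \<open>y\<close> is
    interior to \<open>{c..y+1}\<close> and the derivative within this interval is
    two-sided.\<close>
  define c where "c = y - 1"
  have cont: "continuous_on UNIV fyx" using fy by (simp add: has_partials_def)
  have *: "fx (x, z) - fx (x, c) = integral {c..z} (\<lambda>t. fyx (x, t))" if "z \<ge> c" for z
  proof -
    have "((\<lambda>s. integral (cbox c z) (\<lambda>t. fy (s, t))) has_real_derivative
        integral (cbox c z) (\<lambda>t. fyx (x, t))) (at x within UNIV)"
    proof (rule leibniz_rule_field_derivative)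
      show "((\<lambda>s. fy (s, t)) has_real_derivative fyx (s, t)) (at s within UNIV)" for s t
        using fy by (simp add: has_partials_def)
      show "(\<lambda>t. fy (s, t)) integrable_on cbox c z" for s
        by (intro integrable_continuous continuous_on_compose2[OF has_partials_continuous_on[OF fy, of UNIV]]
            continuous_intros) auto
      show "continuous_on (UNIV \<times> cbox c z) (\<lambda>(s, t). fyx (s, t))"
        using continuous_on_subset[OF cont] by (simp add: split_def)
    qed auto
    moreover have "integral (cbox c z) (\<lambda>t. fy (s, t)) = f (s, z) - f (s, c)" for s
      unfolding cbox_interval
      by (intro integral_unique fundamental_theorem_of_calculus that)
        (use f in \<open>auto simp: has_partials_def has_real_derivative_iff_has_vector_derivative[symmetric]
          intro: has_field_derivative_at_within\<close>)
    ultimately have "((\<lambda>s. f (s, z) - f (s, c)) has_real_derivative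
        integral {c..z} (\<lambda>t. fyx (x, t))) (at x)"
      by simp
    moreover have "((\<lambda>s. f (s, z) - f (s, c)) has_real_derivative fx (x, z) - fx (x, c)) (at x)"
      using f by (auto simp: has_partials_def intro!: derivative_intros)
    ultimately show ?thesis by (rule DERIV_unique[symmetric])
  qed
  have "((\<lambda>z. integral {c..z} (\<lambda>t. fyx (x, t))) has_real_derivative fyx (x, y)) (at y within {c..y+1})"
    by (intro integral_has_real_derivative continuous_on_compose2[OF cont] continuous_intros)
      (auto simp: c_def)
  then have "((\<lambda>z. fx (x, z) - fx (x, c)) has_real_derivative fyx (x, y)) (at y within {c..y+1})"
    by (rule has_field_derivative_transform_within[of _ _ _ _ 1]) (auto simp: c_def *[unfolded c_def])
  moreover have "at y within {c..y+1} = at y"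
    by (rule at_within_interior) (auto simp: c_def)
  ultimately have "((\<lambda>z. fx (x, z) - fx (x, c)) has_real_derivative fyx (x, y)) (at y)"
    by simp
  moreover have "((\<lambda>z. fx (x, z) - fx (x, c)) has_real_derivative fxy (x, y) - 0) (at y)"
    using fx by (intro derivative_intros) (auto simp: has_partials_def)
  ultimately show ?thesis unfolding p by (metis DERIV_unique diff_0_right)
qed

text \<open>Poincare's lemma on the plane: the shared \<open>R\<close> says that
  \<open>P dx + Q dy\<close> is closed, and \<open>M\<close> integrates this form along the segment
  from the origin.\<close>

lemma closed_form_has_potential:
  assumes P: "has_partials P Px R" and Q: "has_partials Q R Qy"
  shows "\<exists>M. has_partials M P Q"
proof -
  define M where "M = (\<lambda>(x, y). integral (cbox 0 1) (\<lambda>t. x * P (t * x, t * y) + y * Q (t * x, t * y)))"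
  have cont [continuous_intros]: "continuous_on S (\<lambda>z. h (u z, v z))"
    if "h \<in> {P, Q, Px, R, Qy}" "continuous_on S u" "continuous_on S v"
    for h S and u v :: "'a::topological_space \<Rightarrow> real"
  proof -
    have "continuous_on UNIV h"
      using that(1) P Q by (auto simp: has_partials_continuous_on[OF P]
          has_partials_continuous_on[OF Q]) (auto simp: has_partials_def)
    then show ?thesis using that(2,3)
      by (auto intro!: continuous_on_compose2[of UNIV h] continuous_intros)
  qed
  note dP = has_partials_compose[OF P] and dQ = has_partials_compose[OF Q]
  have "((\<lambda>s. M (s, y)) has_real_derivative P (x, y)) (at x)" for x y
  proof -
    define k where "k = (\<lambda>x t. P (t * x, t * y) + t * x * Px (t * x, t * y) + t * y * R (t * x, t * y))"
    have "((\<lambda>s. integral (cbox 0 1) (\<lambda>t. s * P (t * s, t * y) + y * Q (t * s, t * y)))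
        has_real_derivative integral (cbox 0 1) (k x)) (at x within UNIV)"
    proof (rule leibniz_rule_field_derivative)
      show "((\<lambda>s. s * P (t * s, t * y) + y * Q (t * s, t * y)) has_real_derivative k s t) (at s within UNIV)" for s t
        unfolding k_def by (rule dP dQ derivative_eq_intros refl)+ (auto simp: algebra_simps)
      show "(\<lambda>t. s * P (t * s, t * y) + y * Q (t * s, t * y)) integrable_on cbox 0 1" for s
        by (intro integrable_continuous continuous_intros) auto
      show "continuous_on (UNIV \<times> cbox 0 1) (\<lambda>(x, t). k x t)"
        unfolding k_def split_def by (intro continuous_intros) auto
    qed auto
    \<comment> \<open>Closedness turns the differentiated integrand into the
      \<open>t\<close>-derivative of \<open>t * P (t * x, t * y)\<close>.\<close>
    moreover have "(k x has_integral 1 * P (1 * x, 1 * y) - 0 * P (0 * x, 0 * y)) {0..1}"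
    proof (rule fundamental_theorem_of_calculus)
      show "((\<lambda>t. t * P (t * x, t * y)) has_vector_derivative k x t) (at t within {0..1})" for t
        unfolding k_def has_real_derivative_iff_has_vector_derivative[symmetric]
        by (rule dP dQ derivative_eq_intros refl)+ (auto simp: algebra_simps)
    qed auto
    ultimately show ?thesis by (auto simp: M_def dest!: integral_unique)
  qed
  moreover have "((\<lambda>s. M (x, s)) has_real_derivative Q (x, y)) (at y)" for x y
  proof -
    define k where "k = (\<lambda>y t. Q (t * x, t * y) + t * x * R (t * x, t * y) + t * y * Qy (t * x, t * y))"
    have "((\<lambda>s. integral (cbox 0 1) (\<lambda>t. x * P (t * x, t * s) + s * Q (t * x, t * s)))
        has_real_derivative integral (cbox 0 1) (k y)) (at y within UNIV)"
    proof (rule leibniz_rule_field_derivative)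
      show "((\<lambda>s. x * P (t * x, t * s) + s * Q (t * x, t * s)) has_real_derivative k s t) (at s within UNIV)" for s t
        unfolding k_def by (rule dP dQ derivative_eq_intros refl)+ (auto simp: algebra_simps)
      show "(\<lambda>t. x * P (t * x, t * s) + s * Q (t * x, t * s)) integrable_on cbox 0 1" for s
        by (intro integrable_continuous continuous_intros) auto
      show "continuous_on (UNIV \<times> cbox 0 1) (\<lambda>(x, t). k x t)"
        unfolding k_def split_def by (intro continuous_intros) auto
    qed auto
    moreover have "(k y has_integral 1 * Q (1 * x, 1 * y) - 0 * Q (0 * x, 0 * y)) {0..1}"
    proof (rule fundamental_theorem_of_calculus)
      show "((\<lambda>t. t * Q (t * x, t * y)) has_vector_derivative k y t) (at t within {0..1})" for t
        unfolding k_def has_real_derivative_iff_has_vector_derivative[symmetric]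
        by (rule dP dQ derivative_eq_intros refl)+ (auto simp: algebra_simps)
    qed auto
    ultimately show ?thesis by (auto simp: M_def dest!: integral_unique)
  qed
  ultimately show ?thesis
    using has_partials_continuous_on[OF P] has_partials_continuous_on[OF Q]
    unfolding has_partials_def by blast
qed

section \<open>Joergens' theorem by Lewy's transform\<close>

text \<open>An expanding map is injective, so its range is open by invariance of domain. Preimages
  of Cauchy sequences are Cauchy, so the range is also complete, hence closed, and connectedness
  leaves only the whole space.\<close>

lemma expanding_surj:
  fixes f :: "'a::euclidean_space \<Rightarrow> 'a"
  assumes cont: "continuous_on UNIV f" and exp: "\<And>x y. dist x y \<le> dist (f x) (f y)"
  shows "surj f"
proof -
  have inj: "inj f"
    using exp by (metis dist_le_zero_iff dist_self injI)
  have "open (range f)"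
    using invariance_of_domain[OF cont open_UNIV inj] .
  moreover have "complete (range f)"
  proof (rule completeI)
    fix s assume s: "\<forall>n. s n \<in> range f" "Cauchy s"
    then have "\<forall>n. \<exists>x. s n = f x" by blast
    then obtain r where r: "\<And>n. s n = f (r n)" by metis
    have "Cauchy r"
      unfolding Cauchy_def
    proof (intro allI impI)
      fix e :: real assume "e > 0"
      then obtain K where "\<forall>m\<ge>K. \<forall>n\<ge>K. dist (s m) (s n) < e"
        using s(2) unfolding Cauchy_def by blast
      then have "\<forall>m\<ge>K. \<forall>n\<ge>K. dist (r m) (r n) < e"
        unfolding r by (blast intro: le_less_trans[OF exp])
      then show "\<exists>K. \<forall>m\<ge>K. \<forall>n\<ge>K. dist (r m) (r n) < e" ..
    qed
    then obtain l where "r \<longlonglongrightarrow> l" using Cauchy_convergent convergent_def by blast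
    then have "(\<lambda>n. f (r n)) \<longlonglongrightarrow> f l"
      using cont by (intro isCont_tendsto_compose[of l f]) (simp_all add: continuous_on_eq_continuous_at)
    moreover have "s = (\<lambda>n. f (r n))" using r by (rule ext)
    ultimately show "\<exists>l\<in>range f. s \<longlonglongrightarrow> l" by blast
  qed
  ultimately show ?thesis
    using clopen[of "range f"] complete_imp_closed by blast
qed

lemma entire_bounded_deriv_constant:
  fixes F :: "complex \<Rightarrow> complex"
  assumes F: "\<And>z. (F has_field_derivative F' z) (at z)" and bd: "\<And>z. norm (F' z) \<le> B"
  shows "F' z = F' w"
proof -
  have "F holomorphic_on UNIV" using F by (metis field_differentiable_def
      field_differentiable_at_within holomorphic_on_def)
  then have "deriv F holomorphic_on UNIV" by (rule holomorphic_deriv) auto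
  moreover have "deriv F = F'" using F by (auto simp: DERIV_imp_deriv)
  moreover have "bounded (range F')" using bd by (auto simp: bounded_iff)
  ultimately have "F' constant_on UNIV" using Liouville_theorem by auto
  then show ?thesis by (auto simp: constant_on_def)
qed

text \<open>For \<open>A = (a, b; b, c)\<close> with determinant 1, the determinant of
  \<open>1 + A\<close> is \<open>2 + a + c\<close>. The formulas apply the adjugate of
  \<open>1 + A\<close>, divided by this determinant, to \<open>(1 + A) (x, y)\<close>.\<close>

lemma inverse_1_plus:
  fixes a b c x y :: real
  assumes det: "a * c - b\<^sup>2 = 1" and J: "2 + a + c > 0"
  shows "((1 + c) * (x + (x * a + y * b)) - b * (y + (x * b + y * c))) / (2 + a + c) = x"
    and "((1 + a) * (y + (x * b + y * c)) - b * (x + (x * a + y * b))) / (2 + a + c) = y"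
proof -
  have "(1 + c) * (x + (x * a + y * b)) - b * (y + (x * b + y * c)) = x * (2 + a + c)"
    using det by algebra
  then show "((1 + c) * (x + (x * a + y * b)) - b * (y + (x * b + y * c))) / (2 + a + c) = x"
    using J by simp
  have "(1 + a) * (y + (x * b + y * c)) - b * (x + (x * a + y * b)) = y * (2 + a + c)"
    using det by algebra
  then show "((1 + a) * (y + (x * b + y * c)) - b * (x + (x * a + y * b))) / (2 + a + c) = y"
    using J by simp
qed

text \<open>If \<open>A\<close> is symmetric with determinant 1, then \<open>(1 - A) (1 + A)\<^sup>-\<^sup>1\<close> is symmetric and
  traceless. Its composition with conjugation is therefore multiplication by a complex number.\<close>

lemma cayley_traceless:
  fixes a b c x y u v :: real
  assumes det: "a * c - b\<^sup>2 = 1" and J: "2 + a + c > 0"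
    and u: "u = ((1 + c) * x - b * y) / (2 + a + c)" and v: "v = ((1 + a) * y - b * x) / (2 + a + c)"
  shows "u - (u * a + v * b) = (c - a) / (2 + a + c) * x - 2 * b / (2 + a + c) * y"
    and "u * b + v * c - v = (c - a) / (2 + a + c) * y + 2 * b / (2 + a + c) * x"
proof -
  have J0: "2 + a + c \<noteq> 0" using J by simp
  have uv: "u * (2 + a + c) = (1 + c) * x - b * y" "v * (2 + a + c) = (1 + a) * y - b * x"
    using u v J by auto
  have "(u - (u * a + v * b)) * (2 + a + c) = (c - a) * x - 2 * b * y"
    using uv det by algebra
  from eq_divide_imp[OF J0 this]
  show "u - (u * a + v * b) = (c - a) / (2 + a + c) * x - 2 * b / (2 + a + c) * y"
    by (simp add: diff_divide_distrib left_diff_distrib)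
  have "(u * b + v * c - v) * (2 + a + c) = (c - a) * y + 2 * b * x"
    using uv det by algebra
  from eq_divide_imp[OF J0 this]
  show "u * b + v * c - v = (c - a) / (2 + a + c) * y + 2 * b / (2 + a + c) * x"
    by (simp add: add_divide_distrib)
qed

text \<open>Joergens' theorem for the potential \<open>\<phi>\<close> with gradient \<open>(M, N)\<close>, by Lewy's transform: since
  \<open>D\<^sup>2\<phi>\<close> is positive definite, \<open>L = id + grad \<phi>\<close> expands distances and so is a diffeomorphism, and
  the conjugate of \<open>id - grad \<phi>\<close>, read in the coordinate \<open>L\<close>, is an entire function with
  bounded derivative.\<close>

lemma hessian_det_1_constant:
  assumes M: "has_partials M a b" and N: "has_partials N b c"
    and a: "\<And>p. a p > 0" and det: "\<And>p. a p * c p - (b p)\<^sup>2 = 1"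
  shows "a p = a q" "b p = b q" "c p = c q"
proof -
  define pr where "pr z = (Re z, Im z)" for z
  \<comment> \<open>\<open>K\<close> is the gradient map \<open>(M, N)\<close> read on the complex
    plane, and \<open>K' z\<close> is its real-linear derivative, the Hessian of the
    potential.\<close>
  define K where "K z = complex_of_real (M (pr z)) + \<i> * complex_of_real (N (pr z))" for z
  define K' where "K' z h = complex_of_real (Re h * a (pr z) + Im h * b (pr z)) +
    \<i> * complex_of_real (Re h * b (pr z) + Im h * c (pr z))" for z h
  have ac: "c p > 0" for p
  proof -
    have "a p * c p > 0" using det[of p] by (smt (verit) zero_le_power2)
    with a[of p] show ?thesis by (simp add: zero_less_mult_iff)
  qed
  have dpr: "(pr has_derivative pr) (at z)" for z
    unfolding pr_def by (auto intro!: derivative_eq_intros)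
  have dK: "(K has_derivative K' z) (at z)" for z
  proof -
    have 1: "((\<lambda>z. M (pr z)) has_derivative (\<lambda>h. Re h * a (pr z) + Im h * b (pr z))) (at z)"
      using has_derivative_compose[OF dpr has_partials_imp_has_derivative[OF M]]
      by (simp add: pr_def)
    have 2: "((\<lambda>z. N (pr z)) has_derivative (\<lambda>h. Re h * b (pr z) + Im h * c (pr z))) (at z)"
      using has_derivative_compose[OF dpr has_partials_imp_has_derivative[OF N]]
      by (simp add: pr_def)
    show ?thesis unfolding K_def K'_def
      by (rule derivative_eq_intros 1 2 refl)+ simp
  qed
  have psd: "0 \<le> K' z h \<bullet> h" for z h
  proof -
    let ?a = "a (pr z)" and ?b = "b (pr z)" and ?c = "c (pr z)"
    \<comment> \<open>Complete the square; \<open>det\<close> reduces the remainder to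
      \<open>(Im h)\<^sup>2\<close>.\<close>
    have "?a * (K' z h \<bullet> h) = (?a * Re h + ?b * Im h)\<^sup>2 + (?a * ?c - ?b\<^sup>2) * (Im h)\<^sup>2"
      by (simp add: K'_def inner_complex_def algebra_simps power2_eq_square)
    also have "\<dots> \<ge> 0" by (simp add: det)
    finally show ?thesis using a[of "pr z"] by (simp add: zero_le_mult_iff)
  qed
  \<comment> \<open>The gradient of a convex function is monotone: along the segment from
    \<open>w\<close> to \<open>z\<close>, the component of \<open>K\<close> in direction
    \<open>z - w\<close> has nonnegative derivative by \<open>psd\<close>.\<close>
  have mono: "0 \<le> (K z - K w) \<bullet> (z - w)" for z w
  proof -
    define \<phi> where "\<phi> t = K (w + t *\<^sub>R (z - w)) \<bullet> (z - w)" for t :: real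
    have d: "(\<phi> has_real_derivative K' (w + t *\<^sub>R (z - w)) (z - w) \<bullet> (z - w)) (at t)" for t
    proof -
      have "((\<lambda>t. w + t *\<^sub>R (z - w)) has_derivative (\<lambda>h. h *\<^sub>R (z - w))) (at t)"
        by (auto intro!: derivative_eq_intros)
      from has_derivative_inner_left[OF has_derivative_compose[OF this dK]]
      have "(\<phi> has_derivative (\<lambda>h. K' (w + t *\<^sub>R (z - w)) (h *\<^sub>R (z - w)) \<bullet> (z - w))) (at t)"
        unfolding \<phi>_def .
      then show ?thesis unfolding has_field_derivative_def
        by (rule has_derivative_eq_rhs)
          (auto simp: fun_eq_iff linear_scale[OF bounded_linear.linear[OF has_derivative_bounded_linear[OF dK]]])
    qed
    have "\<phi> 0 \<le> \<phi> 1"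
      by (rule DERIV_nonneg_imp_nondecreasing) (use d psd in auto)
    then show ?thesis by (simp add: \<phi>_def inner_diff_left)
  qed
  define L where "L z = z + K z" for z
  have dL: "(L has_derivative (\<lambda>h. h + K' z h)) (at z)" for z
    unfolding L_def using dK by (auto intro!: derivative_eq_intros)
  have expand: "dist z w \<le> dist (L z) (L w)" for z w
  proof (cases "z = w")
    case False
    \<comment> \<open>Since \<open>L = id + K\<close>, monotonicity of \<open>K\<close> bounds the
      inner product below by the squared distance; Cauchy-Schwarz then gives expansion.\<close>
    have "norm (z - w) * norm (z - w) \<le> (L z - L w) \<bullet> (z - w)"
      using mono[of z w] by (simp add: L_def algebra_simps power2_norm_eq_inner flip: power2_eq_square)
    also have "\<dots> \<le> norm (L z - L w) * norm (z - w)" by (rule norm_cauchy_schwarz)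
    finally show ?thesis using False by (simp add: dist_norm)
  qed auto
  have "continuous_on UNIV L"
    by (intro continuous_at_imp_continuous_on ballI has_derivative_continuous[OF dL])
  then have surj: "surj L" using expand by (rule expanding_surj)
  define H where "H = inv L"
  have LH: "L (H w) = w" for w using surj by (simp add: H_def surj_f_inv_f)
  \<comment> \<open>Expansion of \<open>L\<close> makes its inverse 1-Lipschitz, which supplies the
    continuity required by the inverse derivative rule.\<close>
  have contH: "isCont H w" for w
  proof -
    have "dist (H v) (H w) \<le> dist v w" for v using expand[of "H v" "H w"] by (simp add: LH)
    then show ?thesis unfolding isCont_def tendsto_iff eventually_at by (meson le_less_trans)
  qed
  txt \<open>By \<open>det\<close>, \<open>J\<close> is the determinant of \<open>1 + D\<^sup>2\<phi>\<close>.\<close>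
  define J where "J p = 2 + a p + c p" for p
  have J: "J p > 0" for p using a[of p] ac[of p] by (simp add: J_def)
  define H' where "H' z k = complex_of_real (((1 + c (pr z)) * Re k - b (pr z) * Im k) / J (pr z)) +
    \<i> * complex_of_real (((1 + a (pr z)) * Im k - b (pr z) * Re k) / J (pr z))" for z k
  have dH: "(H has_derivative H' (H w)) (at w)" for w
  proof (rule has_derivative_inverse_basic[OF dL _ _ contH open_UNIV])
    show "bounded_linear (H' (H w))"
      unfolding linear_conv_bounded_linear[symmetric] H'_def
      by (rule linearI) (simp_all add: complex_eq_iff add_divide_distrib diff_divide_distrib algebra_simps)
    show "H' (H w) \<circ> (\<lambda>h. h + K' (H w) h) = id"
      using inverse_1_plus[OF det J[unfolded J_def]] unfolding fun_eq_iff
      by (simp add: H'_def K'_def complex_eq_iff J_def)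
  qed (auto simp: LH)
  \<comment> \<open>\<open>T p\<close> is the complex multiplier that
    \<open>cayley_traceless\<close> finds for the conjugate of
    \<open>(1 - A) (1 + A)\<^sup>-\<^sup>1\<close>, where \<open>A\<close> is the Hessian at
    \<open>p\<close>.\<close>
  define T where "T p = Complex ((c p - a p) / J p) (2 * b p / J p)" for p
  have dS: "((\<lambda>w. cnj (H w - K (H w))) has_field_derivative T (pr (H w))) (at w)" for w
  proof -
    have "((\<lambda>w. cnj (H w - K (H w))) has_derivative
        (\<lambda>k. cnj (H' (H w) k - K' (H w) (H' (H w) k)))) (at w)"
      by (intro has_derivative_cnj has_derivative_diff dH has_derivative_compose[OF dH dK])
    moreover have "cnj (H' (H w) k - K' (H w) (H' (H w) k)) = T (pr (H w)) * k" for k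
      using cayley_traceless[OF det J[unfolded J_def] refl refl, of "pr (H w)" "Re k" "Im k"]
      by (simp add: H'_def K'_def T_def complex_eq_iff J_def)
    ultimately show ?thesis by (simp add: has_field_derivative_def mult_commute_abs)
  qed
  \<comment> \<open>In other words \<open>|T|\<^sup>2 = 1 - 4 / J\<close>. This bounds
    \<open>T\<close> by 1 for Liouville's theorem and later recovers \<open>J\<close> from
    \<open>T\<close>.\<close>
  have normT: "(norm (T p))\<^sup>2 * J p = J p - 4" for p
  proof -
    have "(norm (T p))\<^sup>2 * (J p)\<^sup>2 = (c p - a p)\<^sup>2 + 4 * (b p)\<^sup>2"
      using J[of p] by (simp add: T_def cmod_power2 power_divide field_simps)
    also have "(b p)\<^sup>2 = a p * c p - 1" using det[of p] by simp
    also have "(c p - a p)\<^sup>2 + 4 * (a p * c p - 1) = (J p - 4) * J p"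
      by (simp add: J_def power2_eq_square algebra_simps)
    finally show ?thesis using J[of p] by (simp add: power2_eq_square)
  qed
  have "norm (T p) \<le> 1" for p
  proof -
    have "(norm (T p))\<^sup>2 * J p \<le> 1 * J p" using normT[of p] by simp
    then have "(norm (T p))\<^sup>2 \<le> 1" using J[of p] by (simp only: mult_le_cancel_right_pos)
    then show ?thesis by (simp add: abs_square_le_1)
  qed
  then have "T (pr (H z)) = T (pr (H w))" for z w
    using entire_bounded_deriv_constant[of _ "\<lambda>w. T (pr (H w))"] dS by blast
  \<comment> \<open>Every point of the plane is reached by \<open>pr\<close> after \<open>H\<close>,
    so constancy in the coordinate \<open>L\<close> means constancy of \<open>T\<close>
    itself.\<close>
  moreover have "pr (H (L (Complex (fst p) (snd p)))) = p" for p
  proof -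
    have "H (L z) = z" for z using expand[of "H (L z)" z] LH by simp
    then show ?thesis by (simp add: pr_def)
  qed
  ultimately have T: "T p = T q" by metis
  \<comment> \<open>Both sides equal 4. Once \<open>J\<close> is known to be constant,
    \<open>T\<close> determines \<open>c - a\<close> and \<open>b\<close>, while \<open>J\<close>
    determines \<open>a + c\<close>.\<close>
  have "J p * (1 - (norm (T p))\<^sup>2) = J q * (1 - (norm (T p))\<^sup>2)"
    using normT[of p] normT[of q] T by (simp add: algebra_simps)
  moreover have "1 - (norm (T p))\<^sup>2 \<noteq> 0" using normT[of p] by auto
  ultimately have Jpq: "J p = J q" by simp
  then have "c p - a p = c q - a q" "b p = b q"
    using T J[of q] by (auto simp: T_def)
  then show "a p = a q" "b p = b q" "c p = c q" using Jpq by (auto simp: J_def)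
qed

section \<open>Liouville's theorem for a linear elliptic system\<close>

text \<open>The shared \<open>s\<close> makes \<open>(u, v)\<close> a curl-free field. Together with
  \<open>eq\<close> this becomes the Cauchy-Riemann system after a linear change of coordinates, so
  a bounded solution is constant.\<close>

lemma elliptic_system_bounded_constant:
  assumes u: "has_partials u r s" and v: "has_partials v s t"
    and eq: "\<And>p. c * r p - 2 * b * s p + a * t p = 0" and det: "a * c - b\<^sup>2 = 1" and a: "a > 0"
    and bd: "\<And>p. \<bar>u p\<bar> \<le> B" "\<And>p. \<bar>v p\<bar> \<le> B"
  shows "u p = u q" "v p = v q"
proof -
  txt \<open>\<open>\<psi>\<close> inverts \<open>(x, y) \<mapsto> (a x + b y, y)\<close>, which turns the operator into a multiple of the Laplacian;
    \<open>f\<close> is \<open>U\<^sub>\<sigma> - \<i> U\<^sub>\<tau>\<close> for a function \<open>U\<close> with gradient \<open>(u, v)\<close> written in these coordinates.\<close>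
  define \<psi> where "\<psi> z = ((Re z - b * Im z) / a, Im z)" for z
  define f where "f z = complex_of_real (u (\<psi> z) / a) + \<i> * complex_of_real (b / a * u (\<psi> z) - v (\<psi> z))" for z
  have d\<psi>: "(\<psi> has_derivative \<psi>) (at z)" for z
    unfolding \<psi>_def using a by (auto intro!: derivative_eq_intros)
  have 1: "((\<lambda>z. u (\<psi> z)) has_derivative (\<lambda>h. fst (\<psi> h) * r (\<psi> z) + snd (\<psi> h) * s (\<psi> z))) (at z)" for z
    by (rule has_derivative_compose[OF d\<psi> has_partials_imp_has_derivative[OF u]])
  have 2: "((\<lambda>z. v (\<psi> z)) has_derivative (\<lambda>h. fst (\<psi> h) * s (\<psi> z) + snd (\<psi> h) * t (\<psi> z))) (at z)" for z
    by (rule has_derivative_compose[OF d\<psi> has_partials_imp_has_derivative[OF v]])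
  have "(f has_field_derivative Complex (r (\<psi> z) / a\<^sup>2) (b * r (\<psi> z) / a\<^sup>2 - s (\<psi> z) / a)) (at z)" for z
  proof -
    define R S T where RST: "R = r (\<psi> z)" "S = s (\<psi> z)" "T = t (\<psi> z)"
    \<comment> \<open>Solve \<open>eq\<close> for the last second-order term, with
      \<open>a * c\<close> replaced by \<open>1 + b\<^sup>2\<close>; this makes the real derivative
      of \<open>f\<close> complex-linear.\<close>
    have "a * a * T = 2 * a * b * S - R - b * b * R"
      using eq[of "\<psi> z"] det unfolding RST[symmetric] by algebra
    then have T: "T = (2 * a * b * S - R - b * b * R) / (a * a)" using a by (simp add: field_simps)
    have "(f has_derivative (\<lambda>h. complex_of_real ((fst (\<psi> h) * r (\<psi> z) + snd (\<psi> h) * s (\<psi> z)) / a) +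
        \<i> * complex_of_real (b / a * (fst (\<psi> h) * r (\<psi> z) + snd (\<psi> h) * s (\<psi> z)) -
          (fst (\<psi> h) * s (\<psi> z) + snd (\<psi> h) * t (\<psi> z))))) (at z)"
      unfolding f_def
      by (intro has_derivative_add has_derivative_of_real has_derivative_mult_right has_derivative_diff
          bounded_linear.has_derivative[OF bounded_linear_divide] 1 2)
    then show ?thesis
      unfolding has_field_derivative_def RST[symmetric] T
      by (rule has_derivative_eq_rhs)
        (use a in \<open>simp add: fun_eq_iff complex_eq_iff \<psi>_def power2_eq_square field_simps\<close>)
  qed
  then have "f holomorphic_on UNIV"
    by (metis field_differentiable_def field_differentiable_at_within holomorphic_on_def)
  moreover have "norm (f z) \<le> B / a + (\<bar>b\<bar> / a * B + B)" for z
  proof -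
    have "norm (f z) \<le> \<bar>u (\<psi> z) / a\<bar> + \<bar>b / a * u (\<psi> z) - v (\<psi> z)\<bar>"
      unfolding f_def by (rule order_trans[OF norm_triangle_ineq]) (simp add: norm_mult del: of_real_diff of_real_divide)
    also have "\<bar>u (\<psi> z) / a\<bar> \<le> B / a" using bd(1)[of "\<psi> z"] a by (simp add: abs_divide divide_right_mono)
    also have "\<bar>b / a * u (\<psi> z) - v (\<psi> z)\<bar> \<le> \<bar>b / a * u (\<psi> z)\<bar> + \<bar>v (\<psi> z)\<bar>" by (rule abs_triangle_ineq4)
    also have "\<bar>b / a * u (\<psi> z)\<bar> \<le> \<bar>b\<bar> / a * B"
      using mult_left_mono[OF bd(1)[of "\<psi> z"], of "\<bar>b\<bar> / a"] a by (simp add: abs_mult abs_divide)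
    also have "\<bar>v (\<psi> z)\<bar> \<le> B" by (rule bd)
    finally show ?thesis by simp
  qed
  then have "bounded (range f)" by (auto simp: bounded_iff)
  ultimately have "f constant_on UNIV" by (rule Liouville_theorem)
  then have *: "f z = f w" for z w by (auto simp: constant_on_def)
  \<comment> \<open>\<open>\<psi>\<close> is onto, so constancy of \<open>f\<close> can be tested at
    any \<open>p\<close> and \<open>q\<close>: the real part gives \<open>u\<close>, and then the
    imaginary part gives \<open>v\<close>.\<close>
  have **: "\<psi> (Complex (a * fst p + b * snd p) (snd p)) = p" for p
    using a by (simp add: \<psi>_def)
  from *[of "Complex (a * fst p + b * snd p) (snd p)" "Complex (a * fst q + b * snd q) (snd q)"]
  show "u p = u q" "v p = v q" using a by (auto simp: f_def ** complex_eq_iff)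
qed

section \<open>Differentiation rules for the metric coefficients\<close>

lemma C1_plane_continuous_on:
  fixes u :: "real \<times> real \<Rightarrow> real ^ 'n"
  assumes "C1_plane u"
  shows "continuous_on S u"
proof -
  have "continuous_on S (\<lambda>p. \<chi> k. u p $ k)"
    by (intro continuous_on_vec_lambda has_partials_continuous_on[OF has_partials_component[OF assms]])
  then show ?thesis by simp
qed

lemma has_partials_cong:
  assumes "has_partials u ux uy" "\<And>p. ux p = ux' p" "\<And>p. uy p = uy' p"
  shows "has_partials u ux' uy'"
  using assms by (simp add: has_partials_def)

lemma has_partials_const: "has_partials (\<lambda>p. k) (\<lambda>p. 0) (\<lambda>p. 0)"
  by (simp add: has_partials_def)

lemma has_partials_diff:
  assumes "has_partials u ux uy" "has_partials v vx vy"
  shows "has_partials (\<lambda>p. u p - v p) (\<lambda>p. ux p - vx p) (\<lambda>p. uy p - vy p)"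
  using assms unfolding has_partials_def
  by (auto intro: DERIV_diff continuous_on_diff)

lemma has_partials_mult:
  assumes "has_partials u ux uy" "has_partials v vx vy"
  shows "has_partials (\<lambda>p. u p * v p) (\<lambda>p. ux p * v p + vx p * u p) (\<lambda>p. uy p * v p + vy p * u p)"
  using assms has_partials_continuous_on[OF assms(1)] has_partials_continuous_on[OF assms(2)]
  unfolding has_partials_def
  by (auto intro: DERIV_mult intro!: continuous_on_add continuous_on_mult)

lemma has_partials_inner:
  fixes u v :: "real \<times> real \<Rightarrow> real ^ 'n"
  assumes u: "C1_plane u" and v: "C1_plane v"
  shows "has_partials (\<lambda>p. u p \<bullet> v p) (\<lambda>p. u p \<bullet> partial_x v p + partial_x u p \<bullet> v p)
    (\<lambda>p. u p \<bullet> partial_y v p + partial_y u p \<bullet> v p)"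
proof -
  have "((\<lambda>s. a s \<bullet> b s) has_real_derivative (a x \<bullet> b' + a' \<bullet> b x)) (at x)"
    if "(a has_vector_derivative a') (at x)" "(b has_vector_derivative b') (at x)"
    for a b :: "real \<Rightarrow> real ^ 'n" and a' b' x
    using bounded_bilinear.has_vector_derivative[OF bounded_bilinear_inner that]
    by (simp add: has_real_derivative_iff_has_vector_derivative)
  from this[OF C1_planeD(1)[OF u] C1_planeD(1)[OF v]] this[OF C1_planeD(2)[OF u] C1_planeD(2)[OF v]]
  show ?thesis
    using C1_planeD(3,4)[OF u] C1_planeD(3,4)[OF v]
      C1_plane_continuous_on[OF u] C1_plane_continuous_on[OF v]
    unfolding has_partials_def by (auto intro!: continuous_intros)
qed

text \<open>Both derivatives are put over the denominator \<open>d * sqrt (d)\<close>, so that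
  comparing mixed terms later involves only numerators free of roots.\<close>

lemma has_partials_divide_sqrt:
  assumes u: "has_partials u ux uy" and d: "has_partials d dx dy" and pos: "\<And>p. d p > 0"
  shows "has_partials (\<lambda>p. u p / sqrt (d p))
    (\<lambda>p. (ux p * d p - u p * dx p / 2) / (d p * sqrt (d p)))
    (\<lambda>p. (uy p * d p - u p * dy p / 2) / (d p * sqrt (d p)))"
proof -
  have D: "((\<lambda>s. a s / sqrt (b s)) has_real_derivative
      (a' * b x - a x * b' / 2) / (b x * sqrt (b x))) (at x)"
    if "(a has_real_derivative a') (at x)" "(b has_real_derivative b') (at x)" "b x > 0"
    for a b :: "real \<Rightarrow> real" and a' b' x
  proof -
    have "((\<lambda>s. a s / sqrt (b s)) has_real_derivative
      (a' * sqrt (b x) - a x * (b' * (inverse (sqrt (b x)) / 2))) / (sqrt (b x) * sqrt (b x))) (at x)"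
      using that by (auto intro!: derivative_eq_intros simp: mult.commute)
    also have "(a' * sqrt (b x) - a x * (b' * (inverse (sqrt (b x)) / 2))) / (sqrt (b x) * sqrt (b x))
      = (a' * (sqrt (b x) * sqrt (b x)) - a x * b' / 2) / (b x * sqrt (b x))"
      using that(3) by (simp add: field_simps)
    finally show ?thesis using that(3) by simp
  qed
  have pos': "0 < d p" "d p \<noteq> 0" for p using pos[of p] by auto
  show ?thesis
    using u d has_partials_continuous_on[OF u] has_partials_continuous_on[OF d] pos'
    unfolding has_partials_def
    by (auto intro!: continuous_intros D)
qed

section \<open>Geometry of graphs and the maximal surface equation\<close>

lemma pseudo_inner_eq:
  "pseudo_inner (a, b, u) (c, d, v) = a * c + b * d - u \<bullet> v"
  by (simp add: pseudo_inner_def inner_vec_def)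

lemma graph_map_partials:
  assumes "C1_plane g"
  shows "partial_x (graph_map g) = (\<lambda>p. (1, 0, partial_x g p))"
    and "partial_y (graph_map g) = (\<lambda>p. (0, 1, partial_y g p))"
proof -
  have "((\<lambda>s. (s, y, g (s, y))) has_vector_derivative (1, 0, partial_x g (x, y))) (at x)" for x y
    using C1_planeD(1)[OF assms]
    by (intro has_vector_derivative_Pair has_vector_derivative_const has_vector_derivative_id)
  then show "partial_x (graph_map g) = (\<lambda>p. (1, 0, partial_x g p))"
    by (auto simp: fun_eq_iff graph_map_def partial_x_def[of "\<lambda>(x, y). (x, y, g (x, y))"] vector_derivative_at)
  have "((\<lambda>t. (x, t, g (x, t))) has_vector_derivative (0, 1, partial_y g (x, y))) (at y)" for x y
    using C1_planeD(2)[OF assms]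
    by (intro has_vector_derivative_Pair has_vector_derivative_const has_vector_derivative_id)
  then show "partial_y (graph_map g) = (\<lambda>p. (0, 1, partial_y g p))"
    by (auto simp: fun_eq_iff graph_map_def partial_y_def[of "\<lambda>(x, y). (x, y, g (x, y))"] vector_derivative_at)
qed

lemma partials_const_Pair:
  assumes "C1_plane u"
  shows "partial_x (\<lambda>p. (a, b, u p)) p = (0, 0, partial_x u p)"
    and "partial_y (\<lambda>p. (a, b, u p)) p = (0, 0, partial_y u p)"
proof -
  obtain x y where p: "p = (x, y)" by fastforce
  have "((\<lambda>s. (a, b, u (s, y))) has_vector_derivative (0, 0, partial_x u (x, y))) (at x)"
    using C1_planeD(1)[OF assms]
    by (intro has_vector_derivative_Pair has_vector_derivative_const)
  then show "partial_x (\<lambda>p. (a, b, u p)) p = (0, 0, partial_x u p)"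
    by (simp add: p partial_x_def[of "\<lambda>p. (a, b, u p)"] vector_derivative_at)
  have "((\<lambda>t. (a, b, u (x, t))) has_vector_derivative (0, 0, partial_y u (x, y))) (at y)"
    using C1_planeD(2)[OF assms]
    by (intro has_vector_derivative_Pair has_vector_derivative_const)
  then show "partial_y (\<lambda>p. (a, b, u p)) p = (0, 0, partial_y u p)"
    by (simp add: p partial_y_def[of "\<lambda>p. (a, b, u p)"] vector_derivative_at)
qed

lemma graph_map_ff:
  assumes "C1_plane g"
  shows "ff_E (graph_map g) p = 1 - partial_x g p \<bullet> partial_x g p"
    and "ff_F (graph_map g) p = - (partial_x g p \<bullet> partial_y g p)"
    and "ff_G (graph_map g) p = 1 - partial_y g p \<bullet> partial_y g p"
  by (simp_all add: ff_E_def ff_F_def ff_G_def graph_map_partials[OF assms] pseudo_inner_eq)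

lemma spacelike_pos:
  assumes "spacelike X"
  shows "ff_E X p > 0" "ff_G X p > 0" "ff_E X p * ff_G X p - (ff_F X p)\<^sup>2 > 0"
proof -
  have *: "ff_E X p * a\<^sup>2 + 2 * ff_F X p * a * b + ff_G X p * b\<^sup>2 > 0" if "(a, b) \<noteq> (0, 0)" for a b
    using assms that unfolding spacelike_def by blast
  show E: "ff_E X p > 0" using *[of 1 0] by simp
  show "ff_G X p > 0" using *[of 0 1] by simp
  \<comment> \<open>Evaluating the metric at the vector \<open>(F, -E)\<close> gives exactly
    \<open>E * (E * G - F\<^sup>2)\<close>.\<close>
  have "ff_E X p * (ff_E X p * ff_G X p - (ff_F X p)\<^sup>2) > 0"
    using *[of "ff_F X p" "- ff_E X p"] E by (simp add: power2_eq_square algebra_simps)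
  with E show "ff_E X p * ff_G X p - (ff_F X p)\<^sup>2 > 0" by (simp add: zero_less_mult_iff)
qed

text \<open>Second derivatives of a graph have the form \<open>(0, 0, r)\<close>. The first two
  components of a normal part are therefore the negated tangential coefficients, and their vanishing
  in the mean curvature removes the tangential terms from the third component.\<close>

lemma maximal_graph_equation:
  fixes g :: "real \<times> real \<Rightarrow> real ^ 'n"
  assumes g: "C2_plane g" and max: "maximal_surface (graph_map g)"
  defines "E \<equiv> ff_E (graph_map g)" and "F \<equiv> ff_F (graph_map g)" and "G \<equiv> ff_G (graph_map g)"
  shows "G p *\<^sub>R partial_x (partial_x g) p - (2 * F p) *\<^sub>R partial_y (partial_x g) p
    + E p *\<^sub>R partial_y (partial_y g) p = 0" (is "?w = 0")
proof -
  let ?P = "partial_x g p" and ?Q = "partial_y g p"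
  have g1: "C1_plane g" "C1_plane (partial_x g)" "C1_plane (partial_y g)"
    using g by (auto simp: C2_plane_def)
  obtain \<alpha> \<beta> where np: "\<And>r. normal_part (graph_map g) p (0, 0, r)
      = (- \<alpha> r, - \<beta> r, r - \<alpha> r *\<^sub>R ?P - \<beta> r *\<^sub>R ?Q)"
  proof
    fix r
    let ?u = "- (r \<bullet> ?P)" and ?v = "- (r \<bullet> ?Q)"
    show "normal_part (graph_map g) p (0, 0, r)
      = (- ((G p * ?u - F p * ?v) / (E p * G p - (F p)\<^sup>2)),
         - ((E p * ?v - F p * ?u) / (E p * G p - (F p)\<^sup>2)),
         r - ((G p * ?u - F p * ?v) / (E p * G p - (F p)\<^sup>2)) *\<^sub>R ?P
           - ((E p * ?v - F p * ?u) / (E p * G p - (F p)\<^sup>2)) *\<^sub>R ?Q)"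
      by (simp add: normal_part_def Let_def graph_map_partials[OF g1(1)] pseudo_inner_eq E_def F_def G_def)
  qed
  let ?R = "partial_x (partial_x g) p" and ?S = "partial_y (partial_x g) p"
    and ?T = "partial_y (partial_y g) p"
  have pos: "E p * G p - (F p)\<^sup>2 > 0"
    using max spacelike_pos(3)[of "graph_map g" p] by (simp add: maximal_surface_def E_def F_def G_def)
  have "mean_curvature (graph_map g) p = 0" using max unfolding maximal_surface_def by blast
  then have "G p *\<^sub>R normal_part (graph_map g) p (0, 0, ?R)
      - (2 * F p) *\<^sub>R normal_part (graph_map g) p (0, 0, ?S)
      + E p *\<^sub>R normal_part (graph_map g) p (0, 0, ?T) = 0"
    using pos
    by (simp add: mean_curvature_def E_def[symmetric] F_def[symmetric] G_def[symmetric]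
        graph_map_partials[OF g1(1)] partials_const_Pair g1)
  then have "G p *\<^sub>R (- \<alpha> ?R) - (2 * F p) *\<^sub>R (- \<alpha> ?S) + E p *\<^sub>R (- \<alpha> ?T) = 0 \<and>
      G p *\<^sub>R (- \<beta> ?R) - (2 * F p) *\<^sub>R (- \<beta> ?S) + E p *\<^sub>R (- \<beta> ?T) = 0 \<and>
      G p *\<^sub>R (?R - \<alpha> ?R *\<^sub>R ?P - \<beta> ?R *\<^sub>R ?Q)
      - (2 * F p) *\<^sub>R (?S - \<alpha> ?S *\<^sub>R ?P - \<beta> ?S *\<^sub>R ?Q)
      + E p *\<^sub>R (?T - \<alpha> ?T *\<^sub>R ?P - \<beta> ?T *\<^sub>R ?Q) = 0"
    by (simp only: np scaleR_Pair diff_Pair add_Pair zero_prod_def prod.inject)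
  then have 1: "G p *\<^sub>R (- \<alpha> ?R) - (2 * F p) *\<^sub>R (- \<alpha> ?S) + E p *\<^sub>R (- \<alpha> ?T) = 0"
    and 2: "G p *\<^sub>R (- \<beta> ?R) - (2 * F p) *\<^sub>R (- \<beta> ?S) + E p *\<^sub>R (- \<beta> ?T) = 0"
    and 3: "G p *\<^sub>R (?R - \<alpha> ?R *\<^sub>R ?P - \<beta> ?R *\<^sub>R ?Q)
      - (2 * F p) *\<^sub>R (?S - \<alpha> ?S *\<^sub>R ?P - \<beta> ?S *\<^sub>R ?Q)
      + E p *\<^sub>R (?T - \<alpha> ?T *\<^sub>R ?P - \<beta> ?T *\<^sub>R ?Q) = 0"
    by blast+
  \<comment> \<open>Adding back the tangential terms expresses the operator through the three
    vanishing components.\<close>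
  have "?w = (G p *\<^sub>R (?R - \<alpha> ?R *\<^sub>R ?P - \<beta> ?R *\<^sub>R ?Q)
      - (2 * F p) *\<^sub>R (?S - \<alpha> ?S *\<^sub>R ?P - \<beta> ?S *\<^sub>R ?Q)
      + E p *\<^sub>R (?T - \<alpha> ?T *\<^sub>R ?P - \<beta> ?T *\<^sub>R ?Q))
      - (G p *\<^sub>R (- \<alpha> ?R) - (2 * F p) *\<^sub>R (- \<alpha> ?S) + E p *\<^sub>R (- \<alpha> ?T)) *\<^sub>R ?P
      - (G p *\<^sub>R (- \<beta> ?R) - (2 * F p) *\<^sub>R (- \<beta> ?S) + E p *\<^sub>R (- \<beta> ?T)) *\<^sub>R ?Q"
    by (simp add: algebra_simps)
  then show ?thesis unfolding 1 2 3 by simp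
qed

section \<open>A maximal graph over the whole plane has constant gradient\<close>

lemma maximal_graph_gradient_constant:
  fixes g :: "real \<times> real \<Rightarrow> real ^ 'n"
  assumes g: "C2_plane g" and max: "maximal_surface (graph_map g)"
  shows "partial_x g p = partial_x g q" "partial_y g p = partial_y g q"
proof -
  define P Q where "P = partial_x g" and "Q = partial_y g"
  define R S T where "R = partial_x P" and "S = partial_y P" and "T = partial_y Q"
  have g1: "C1_plane g" "C1_plane P" "C1_plane Q"
    using g by (auto simp: C2_plane_def P_def Q_def)
  have S: "partial_x Q = S"
  proof
    fix p
    show "partial_x Q p = S p"
      unfolding vec_eq_iff S_def
    proof
      fix k
      have "has_partials (\<lambda>p. g p $ k) (\<lambda>p. P p $ k) (\<lambda>p. Q p $ k)"
        using has_partials_component[OF g1(1)] by (simp add: P_def Q_def)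
      from mixed_partials_eq[OF this has_partials_component[OF g1(2)] has_partials_component[OF g1(3)]]
      show "partial_x Q p $ k = partial_y P p $ k" by simp
    qed
  qed
  define E F G D where "E p = 1 - P p \<bullet> P p" and "F p = 0 - P p \<bullet> Q p"
    and "G p = 1 - Q p \<bullet> Q p" and "D p = E p * G p - F p * F p" for p
  have ff: "ff_E (graph_map g) = E" "ff_F (graph_map g) = F" "ff_G (graph_map g) = G"
    using graph_map_ff[OF g1(1)] by (auto simp: E_def F_def G_def P_def Q_def)
  have E0: "E p > 0" and G0: "G p > 0" and D0: "D p > 0" for p
    using spacelike_pos[of "graph_map g" p] max
    by (simp_all add: maximal_surface_def ff D_def power2_eq_square)
  have eqn: "G p *\<^sub>R R p - (2 * F p) *\<^sub>R S p + E p *\<^sub>R T p = 0" for p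
    using maximal_graph_equation[OF g max, of p] by (simp add: ff R_def S_def T_def P_def Q_def)
  \<comment> \<open>The derivatives of \<open>E\<close>, \<open>F\<close>, \<open>G\<close> involve
    second derivatives of \<open>g\<close> only through these six products, which \<open>eqP\<close>
    and \<open>eqQ\<close> relate.\<close>
  define pr ps pt qr qs qt where "pr p = R p \<bullet> P p" and "ps p = S p \<bullet> P p" and "pt p = T p \<bullet> P p"
    and "qr p = R p \<bullet> Q p" and "qs p = S p \<bullet> Q p" and "qt p = T p \<bullet> Q p" for p
  note dots = pr_def ps_def pt_def qr_def qs_def qt_def
  have eqP: "G p * pr p - 2 * F p * ps p + E p * pt p = 0"
    and eqQ: "G p * qr p - 2 * F p * qs p + E p * qt p = 0" for p
    using arg_cong[OF eqn[of p], of "\<lambda>w. w \<bullet> P p"] arg_cong[OF eqn[of p], of "\<lambda>w. w \<bullet> Q p"]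
    by (simp_all add: dots inner_diff_left inner_add_left)
  have dE: "has_partials E (\<lambda>p. - 2 * pr p) (\<lambda>p. - 2 * ps p)"
    by (rule has_partials_cong[OF has_partials_diff[OF has_partials_const has_partials_inner[OF g1(2,2)],
          of 1, folded E_def]])
      (simp_all add: dots R_def S_def inner_commute)
  have dF: "has_partials F (\<lambda>p. - (ps p + qr p)) (\<lambda>p. - (pt p + qs p))"
    by (rule has_partials_cong[OF has_partials_diff[OF has_partials_const has_partials_inner[OF g1(2,3)],
          of 0, folded F_def]])
      (simp_all add: dots R_def S_def[symmetric] S T_def inner_commute)
  have dG: "has_partials G (\<lambda>p. - 2 * qs p) (\<lambda>p. - 2 * qt p)"
    by (rule has_partials_cong[OF has_partials_diff[OF has_partials_const has_partials_inner[OF g1(3,3)],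
          of 1, folded G_def]])
      (simp_all add: dots S T_def inner_commute)
  define Dx Dy where "Dx p = - 2 * pr p * G p - 2 * qs p * E p + 2 * (ps p + qr p) * F p"
    and "Dy p = - 2 * ps p * G p - 2 * qt p * E p + 2 * (pt p + qs p) * F p" for p
  have dD: "has_partials D Dx Dy"
    by (rule has_partials_cong[OF has_partials_diff[OF has_partials_mult[OF dE dG] has_partials_mult[OF dF dF],
      folded D_def]]) (simp_all add: Dx_def Dy_def algebra_simps)
  note dEW = has_partials_divide_sqrt[OF dE dD D0]
    and dFW = has_partials_divide_sqrt[OF dF dD D0]
    and dGW = has_partials_divide_sqrt[OF dG dD D0]
  \<comment> \<open>Closedness of \<open>(E dx + F dy) / W\<close>, with denominators cleared: the
    two sides differ by \<open>F\<close> times \<open>eqP\<close> minus \<open>E\<close> times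
    \<open>eqQ\<close>.\<close>
  have curl1: "- (ps p + qr p) * D p - F p * Dx p / 2 = - 2 * ps p * D p - E p * Dy p / 2" for p
    using arg_cong2[OF eqP[of p] eqQ[of p], of "\<lambda>u v. F p * u - E p * v"]
    by (simp add: D_def Dx_def Dy_def add_divide_distrib diff_divide_distrib algebra_simps)
  \<comment> \<open>Closedness of \<open>(F dx + G dy) / W\<close>: here the difference is
    \<open>G\<close> times \<open>eqP\<close> minus \<open>F\<close> times
    \<open>eqQ\<close>.\<close>
  have curl2: "- 2 * qs p * D p - G p * Dx p / 2 = - (pt p + qs p) * D p - F p * Dy p / 2" for p
    using arg_cong2[OF eqP[of p] eqQ[of p], of "\<lambda>u v. G p * u - F p * v"]
    by (simp add: D_def Dx_def Dy_def add_divide_distrib diff_divide_distrib algebra_simps)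
  define a b c where "a = (\<lambda>p. E p / sqrt (D p))" and "b = (\<lambda>p. F p / sqrt (D p))"
    and "c = (\<lambda>p. G p / sqrt (D p))"
  have "has_partials (\<lambda>p. F p / sqrt (D p))
      (\<lambda>p. (- 2 * ps p * D p - E p * Dy p / 2) / (D p * sqrt (D p)))
      (\<lambda>p. (- (pt p + qs p) * D p - F p * Dy p / 2) / (D p * sqrt (D p)))"
    using dFW unfolding curl1 .
  from closed_form_has_potential[OF dEW this] obtain M where M: "has_partials M a b"
    unfolding a_def b_def by blast
  have "has_partials (\<lambda>p. G p / sqrt (D p))
      (\<lambda>p. (- (pt p + qs p) * D p - F p * Dy p / 2) / (D p * sqrt (D p)))
      (\<lambda>p. (- 2 * qt p * D p - G p * Dy p / 2) / (D p * sqrt (D p)))"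
    using dGW unfolding curl2 .
  from closed_form_has_potential[OF dFW this] obtain N where N: "has_partials N b c"
    unfolding b_def c_def by blast
  have apos: "a p > 0" for p using E0 D0 by (simp add: a_def)
  have det: "a p * c p - (b p)\<^sup>2 = 1" for p
  proof -
    have "a p * c p - (b p)\<^sup>2 = (E p * G p - F p * F p) / (sqrt (D p) * sqrt (D p))"
      by (simp add: a_def b_def c_def power2_eq_square diff_divide_distrib)
    then show ?thesis using D0[of p] by (simp add: D_def[symmetric])
  qed
  note const = hessian_det_1_constant[OF M N apos det]
  have "P p $ k = P q $ k \<and> Q p $ k = Q q $ k" for k
  proof -
    have PQ: "has_partials (\<lambda>p. P p $ k) (\<lambda>p. R p $ k) (\<lambda>p. S p $ k)"
      "has_partials (\<lambda>p. Q p $ k) (\<lambda>p. S p $ k) (\<lambda>p. T p $ k)"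
      using has_partials_component[OF g1(2)] has_partials_component[OF g1(3)]
      by (simp_all add: R_def S_def[symmetric] S T_def)
    \<comment> \<open>Dividing the equation at \<open>p\<close> by \<open>sqrt (D p)\<close>
      produces the coefficients \<open>a p\<close>, \<open>b p\<close>, \<open>c p\<close>, which
      \<open>const\<close> freezes at the origin.\<close>
    have lin: "c 0 * R p $ k - 2 * b 0 * S p $ k + a 0 * T p $ k = 0" for p
    proof -
      have "G p * R p $ k - 2 * F p * S p $ k + E p * T p $ k = 0"
        using arg_cong[OF eqn[of p], of "\<lambda>w. w $ k"] by simp
      then have "(G p * R p $ k - 2 * F p * S p $ k + E p * T p $ k) / sqrt (D p) = 0" by simp
      then show ?thesis
        unfolding const[of 0 p] by (simp add: a_def b_def c_def diff_divide_distrib add_divide_distrib)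
    qed
    \<comment> \<open>Positivity of \<open>E\<close> and \<open>G\<close> says that the vectors
      \<open>P p\<close> and \<open>Q p\<close> have norm below 1.\<close>
    have bd: "\<bar>P p $ k\<bar> \<le> 1" "\<bar>Q p $ k\<bar> \<le> 1" for p
      using component_le_norm_cart[of "P p" k] component_le_norm_cart[of "Q p" k] E0[of p] G0[of p]
      by (auto simp: E_def G_def power2_norm_eq_inner[symmetric] abs_square_less_1)
    show ?thesis
      using elliptic_system_bounded_constant[OF PQ lin det apos bd] by blast
  qed
  then show "partial_x g p = partial_x g q" "partial_y g p = partial_y g q"
    by (simp_all add: vec_eq_iff P_def Q_def)
qed

section \<open>From constant gradient to a spacelike plane\<close>

lemma constant_gradient_imp_affine:
  fixes g :: "real \<times> real \<Rightarrow> real ^ 'n"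
  assumes g: "C1_plane g" and A: "\<And>p. partial_x g p = A" and B: "\<And>p. partial_y g p = B"
  shows "g p = g 0 + fst p *\<^sub>R A + snd p *\<^sub>R B"
proof -
  have "g p $ k = g 0 $ k + fst p * A $ k + snd p * B $ k" for k
  proof -
    have "((\<lambda>p. fst p * A $ k + snd p * B $ k) has_derivative (\<lambda>h. fst h * A $ k + snd h * B $ k)) (at p)" for p
      by (auto intro!: derivative_eq_intros)
    from has_derivative_diff[OF has_partials_imp_has_derivative[OF has_partials_component[OF g, of k]] this]
    have "((\<lambda>p. g p $ k - (fst p * A $ k + snd p * B $ k)) has_derivative (\<lambda>h. 0)) (at p)" for p
      by (simp add: A B)
    from has_derivative_zero_unique[OF convex_UNIV this, of p 0] show ?thesis by simp
  qed
  then show ?thesis by (simp add: vec_eq_iff)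
qed

theorem corollary14:
  fixes g :: "real \<times> real \<Rightarrow> real ^ 'n::{finite,linorder}"
  assumes "CARD('n) \<ge> 2"
    and "C2_plane g"
    and "maximal_surface (graph_map g)"
    and "positive_area_angle g"
  shows "spacelike_plane (range (graph_map g))"
proof -
  define A B where "A = partial_x g 0" and "B = partial_y g 0"
  have g1: "C1_plane g" using assms(2) by (simp add: C2_plane_def)
  have A: "partial_x g p = A" and B: "partial_y g p = B" for p
    using maximal_graph_gradient_constant[OF assms(2,3)] by (auto simp: A_def B_def)
  define L where "L p = (fst p, snd p, fst p *\<^sub>R A + snd p *\<^sub>R B)" for p :: "real \<times> real"
  have graph: "graph_map g p = (0, 0, g 0) + L p" for p
    using constant_gradient_imp_affine[OF g1 A B, of p] by (cases p) (simp add: graph_map_def L_def)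
  have L: "linear L" by (rule linearI) (auto simp: L_def algebra_simps)
  have inj: "inj L" by (auto simp: inj_on_def L_def prod_eq_iff)
  have range: "range (graph_map g) = (+) (0, 0, g 0) ` range L"
    by (auto simp: graph image_image)
  have "affine (range (graph_map g))"
    unfolding range affine_translation[symmetric]
    by (intro subspace_imp_affine linear_subspace_image[OF L]) simp
  moreover have "aff_dim (range (graph_map g)) = 2"
    unfolding range by (simp add: aff_dim_translation_eq aff_dim_injective_linear_image[OF L inj])
  moreover have "pseudo_inner (graph_map g p - graph_map g q) (graph_map g p - graph_map g q) > 0"
    if "graph_map g p \<noteq> graph_map g q" for p q
  proof -
    obtain x y where xy: "p - q = (x, y)" by fastforce
    have "(x, y) \<noteq> (0, 0)" using that xy by (metis right_minus_eq zero_prod_def)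
    \<comment> \<open>With constant gradient, the pseudo-norm of a chord is the induced metric at
      the origin evaluated on \<open>p - q\<close>.\<close>
    then have "ff_E (graph_map g) 0 * x\<^sup>2 + 2 * ff_F (graph_map g) 0 * x * y + ff_G (graph_map g) 0 * y\<^sup>2 > 0"
      using assms(3) unfolding maximal_surface_def spacelike_def by blast
    moreover have "graph_map g p - graph_map g q = (x, y, x *\<^sub>R A + y *\<^sub>R B)"
      using xy by (cases p; cases q) (auto simp: graph L_def algebra_simps)
    ultimately show ?thesis
      by (simp add: graph_map_ff[OF g1] A B pseudo_inner_eq inner_add_left inner_add_right
          inner_commute power2_eq_square algebra_simps)
  qed
  ultimately show ?thesis unfolding spacelike_plane_def by auto
qed

end
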